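(* Let $n\geq 1$ and $m\geq n$ be integers with $m\geq n\ln n$, and let the processing times $t_{ij}$ ($i\in\{1,\dots,n\}$, $j\in\{1,\dots,m\}$) be i.i.d. random variables drawn from a continuous MHR distribution $\mathcal D$ on $[0,\infty)$. Then $$\mathbb E[\mathrm{VCG}(\mathbf t)]\leq 4\,\mathbb E[\mathrm{OPT}(\mathbf t)].$$
   Context: There are $n$ machines and $m\ge n$ tasks; $t_{ij}\ge 0$ is the processing time of task $j$ on machine $i$, and $\mathbf t=(t_{ij})$. The VCG allocation assigns each task $j$ to a machine $i$ with $t_{ij}=\min_{i'}t_{i'j}$, ties (which have probability zero for continuous distributions) being broken uniformly at random. With $\alpha_{ij}\in\{0,1\}$ indicating whether VCG assigns task $j$ to machine $i$, $\mathrm{VCG}(\mathbf t)=\max_i\sum_{j=1}^m\alpha_{ij}t_{ij}$ is its makespan. $\mathrm{OPT}(\mathbf t)$ is the minimum, over all assignments $a:\{1,\dots,m\}\to\{1,\dots,n\}$ of tasks to machines, of the makespan $\max_i\sum_{j:a(j)=i}t_{ij}$. A continuous distribution with pdf $f$ and cdf $F$ is MHR (monotone hazard rate) if its hazard rate $h(x)=\frac{f(x)}{1-F(x)}$ is weakly increasing (on the set where $F(x)<1$). *)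

theory Defs
  imports "HOL-Probability.Probability"
begin

text \<open>
  Machines are indexed by \<open>{1..n}\<close> and tasks by \<open>{1..m}\<close>; \<open>t i j\<close> is the processing time of
  task \<open>j\<close> on machine \<open>i\<close>. An assignment is a function in \<open>{1..m} \<rightarrow>\<^sub>E {1..n}\<close>.
\<close>

definition makespan :: "nat \<Rightarrow> nat \<Rightarrow> (nat \<Rightarrow> nat \<Rightarrow> real) \<Rightarrow> (nat \<Rightarrow> nat) \<Rightarrow> real" where
  "makespan n m t a = Max ((\<lambda>i. \<Sum>j\<in>{j \<in> {1..m}. a j = i}. t i j) ` {1..n})"

definition OPT :: "nat \<Rightarrow> nat \<Rightarrow> (nat \<Rightarrow> nat \<Rightarrow> real) \<Rightarrow> real" where
  "OPT n m t = Min (makespan n m t ` ({1..m} \<rightarrow>\<^sub>E {1..n}))"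

definition fastest_machines :: "nat \<Rightarrow> (nat \<Rightarrow> nat \<Rightarrow> real) \<Rightarrow> nat \<Rightarrow> nat set" where
  "fastest_machines n t j = {i \<in> {1..n}. t i j = Min ((\<lambda>i'. t i' j) ` {1..n})}"

text \<open>
  Ties are broken uniformly at random, independently for each task, so for fixed processing times
  the VCG allocation is a random assignment.
\<close>

definition VCG_allocation :: "nat \<Rightarrow> nat \<Rightarrow> (nat \<Rightarrow> nat \<Rightarrow> real) \<Rightarrow> (nat \<Rightarrow> nat) pmf" where
  "VCG_allocation n m t =
     Pi_pmf {1..m} undefined (\<lambda>j. pmf_of_set (fastest_machines n t j))"

text \<open>
  The VCG makespan for processing times \<open>t\<close>, averaged over the tie-breaking only. Without ties
  this is the makespan of the unique VCG allocation. Integrating it over random \<open>t\<close> gives the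
  expectation over both the processing times and the tie-breaking.
\<close>

definition VCG :: "nat \<Rightarrow> nat \<Rightarrow> (nat \<Rightarrow> nat \<Rightarrow> real) \<Rightarrow> real" where
  "VCG n m t = measure_pmf.expectation (VCG_allocation n m t) (makespan n m t)"

definition is_pdf :: "real measure \<Rightarrow> (real \<Rightarrow> real) \<Rightarrow> bool" where
  "is_pdf D f \<longleftrightarrow> f \<in> borel_measurable borel \<and> (\<forall>x. 0 \<le> f x) \<and>
     D = density lborel (\<lambda>x. ennreal (f x))"

definition hazard_rate :: "real measure \<Rightarrow> (real \<Rightarrow> real) \<Rightarrow> real \<Rightarrow> real" where
  "hazard_rate D f x = f x / (1 - cdf D x)"

text \<open>
  A density is determined by the distribution only up to a null set; the distribution is MHR if
  some version of its density has a weakly increasing hazard rate.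
\<close>

definition continuous_MHR :: "real measure \<Rightarrow> bool" where
  "continuous_MHR D \<longleftrightarrow> real_distribution D \<and>
     (\<exists>f. is_pdf D f \<and> mono_on {x. cdf D x < 1} (hazard_rate D f))"

end

theory Submission
  imports Defs
begin

text \<open>
  Write \<open>Y\<^sub>j = min\<^sub>i t\<^sub>i\<^sub>j\<close>, with mean \<open>\<mu>\<close>. The average load bounds the optimum from below, so
  \<open>E OPT \<ge> m \<mu> / n\<close>. For the upper bound use a Chernoff argument with \<open>s = 1 / (2 \<mu>)\<close>. The MHR
  condition makes \<open>x \<mapsto> P(Y\<^sub>j > x)\<^sup>1\<^sup>/\<^sup>x\<close> decreasing, so this survival function crosses that of the
  exponential distribution of the same mean at most once, from above, which gives
  \<open>E exp(s Y\<^sub>j) \<le> 1 / (1 - s \<mu>) = 2\<close>. By symmetry a given machine receives task \<open>j\<close> with probability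
  \<open>1/n\<close>, independently of \<open>Y\<^sub>j\<close>, so the exponential moment of its load is at most \<open>(1 + 1/n)\<^sup>m\<close> and
  \<open>E VCG \<le> ln (n (1 + 1/n)\<^sup>m) / s \<le> 2 \<mu> (ln n + m/n) \<le> 4 m \<mu> / n\<close>.
\<close>

subsection \<open>Survival functions of MHR distributions\<close>

text \<open>
  A discrete Gronwall inequality, since the density need not be continuous and the survival function
  therefore not differentiable. The rate \<open>c\<close> may be negative.
\<close>

lemma exp_step_bound:
  fixes S :: "real \<Rightarrow> real"
  assumes "a \<le> b"
    and step: "\<And>u v. a \<le> u \<Longrightarrow> u \<le> v \<Longrightarrow> v \<le> b \<Longrightarrow> S v * (1 + c * (v - u)) \<le> S u"
  shows "S b * exp (c * (b - a)) \<le> S a"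
proof (rule tendsto_upperbound)
  show "(\<lambda>N. S b * (1 + c * (b - a) / real N) ^ N) \<longlonglongrightarrow> S b * exp (c * (b - a))"
    by (intro tendsto_mult tendsto_const tendsto_exp_limit_sequentially)
  show "\<forall>\<^sub>F N in sequentially. S b * (1 + c * (b - a) / real N) ^ N \<le> S a"
  proof -
    \<comment> \<open>With at least \<open>N0\<close> subintervals every factor
      \<open>1 + c * d\<close> is nonnegative even for negative \<open>c\<close>, so the one-step
      inequalities can be chained by multiplication.\<close>
    obtain N0 :: nat where N0: "\<bar>c * (b - a)\<bar> < real N0"
      using reals_Archimedean2 by blast
    show ?thesis
    proof (rule eventually_sequentiallyI[of N0])
      fix N :: nat assume "N0 \<le> N"
      with N0 have N: "\<bar>c * (b - a)\<bar> < real N" by simp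
      define d where "d = (b - a) / real N"
      have d: "0 \<le> d" "real N * d = b - a" using N \<open>a \<le> b\<close> by (auto simp: d_def)
      have "\<bar>c * d\<bar> < 1" using N by (simp add: d_def abs_mult field_simps)
      hence pos: "0 \<le> 1 + c * d" by linarith
      have "S (a + real k * d) * (1 + c * d) ^ k \<le> S a" if "k \<le> N" for k
        using that
      proof (induction k)
        case 0 thus ?case by simp
      next
        case (Suc k)
        have le: "real (Suc k) * d \<le> real N * d"
          using Suc.prems d(1) by (intro mult_right_mono) auto
        have "S (a + real (Suc k) * d) * (1 + c * d) \<le> S (a + real k * d)"
          using step[of "a + real k * d" "a + real (Suc k) * d"] d le by (simp add: algebra_simps)
        from mult_right_mono[OF this, of "(1 + c * d) ^ k"] pos Suc
        show ?case by (simp add: algebra_simps)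
      qed
      from this[of N] d show "S b * (1 + c * (b - a) / real N) ^ N \<le> S a"
        by (simp add: d_def)
    qed
  qed
qed simp

lemma (in real_distribution) survival_diff:
  assumes "u \<le> v"
  shows "measure M {u<..v} = (1 - cdf M u) - (1 - cdf M v)"
  using cdf_diff_eq[of u v] assms by (cases "u = v") auto

text \<open>A density leaves no atom at 0. The survival function therefore has the value 1 at 0, the
  anchor of the comparison with exponentials.\<close>

lemma is_pdf_cdf_0:
  assumes "real_distribution D" "is_pdf D f" "AE x in D. 0 \<le> x"
  shows "cdf D 0 = 0"
proof -
  interpret real_distribution D by fact
  have [measurable]: "f \<in> borel_measurable borel" and D_eq: "D = density lborel (\<lambda>x. ennreal (f x))"
    using assms(2) by (auto simp: is_pdf_def)
  have "AE x in D. x \<noteq> 0"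
    by (subst D_eq, subst AE_density) (auto intro: eventually_mono[OF AE_lborel_singleton[of 0]])
  with assms(3) have "AE x in D. x \<notin> {..0}" by eventually_elim auto
  thus ?thesis unfolding cdf_def by (subst prob_eq_0) auto
qed

text \<open>An increasing hazard rate means that \<open>- ln (1 - cdf D x)\<close> is convex, and it
  vanishes at 0, so its slope seen from the origin is increasing. The comparison with
  \<open>exp (- c * x)\<close> expresses this without logarithms or division by \<open>x\<close>, in
  the form that yields a single crossing.\<close>

lemma MHR_survival_star_shaped:
  assumes "continuous_MHR D" "AE x in D. 0 \<le> x"
    and "0 \<le> y" "y \<le> x" "exp (- c * x) \<le> 1 - cdf D x"
  shows "exp (- c * y) \<le> 1 - cdf D y"
proof -
  from assms(1) obtain f where D: "real_distribution D" and f: "is_pdf D f"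
    and h: "mono_on {x. cdf D x < 1} (hazard_rate D f)"
    by (auto simp: continuous_MHR_def)
  interpret real_distribution D by fact
  define S where "S = (\<lambda>z. 1 - cdf D z)"
  define h where "h = hazard_rate D f"
  \<comment> \<open>On the logarithmic scale, \<open>z \<mapsto> S y exp (- h y (z - y))\<close> is a supporting line of \<open>S\<close> at \<open>y\<close>:
    \<open>right\<close> evaluates it at \<open>x\<close> and \<open>left\<close> at \<open>0\<close>.\<close>
  have f_nonneg: "0 \<le> f z" and [measurable]: "f \<in> borel_measurable borel"
    and D_eq: "D = density lborel (\<lambda>x. ennreal (f x))" for z
    using f by (auto simp: is_pdf_def)
  \<comment> \<open>The survival function dominates a positive number at \<open>x\<close>, so it is
    positive on \<open>{..x}\<close> and the hazard rate has a nonzero denominator there.\<close>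
  have S_pos: "0 < S z" if "z \<le> x" for z
    using cdf_nondecreasing[OF that] assms(5) exp_gt_zero[of "- c * x"] unfolding S_def by linarith
  have S_nonneg: "0 \<le> S z" for z by (simp add: S_def cdf_bounded_prob)
  have S_mono: "S v \<le> S u" if "u \<le> v" for u v
    using cdf_nondecreasing[OF that] by (simp add: S_def)
  have f_eq: "f z = h z * S z" if "z \<le> x" for z
    using S_pos[OF that] by (auto simp: h_def hazard_rate_def S_def)
  have h_nonneg: "0 \<le> h z" for z
    using f_nonneg S_nonneg by (simp add: h_def hazard_rate_def S_def)
  have h_mono: "h u \<le> h v" if "u \<le> v" "v \<le> x" for u v
    using h that S_pos[of u] S_pos[of v] by (auto simp: mono_on_def h_def S_def)
  have emeasure_Ioc: "emeasure D {u<..v} = (\<integral>\<^sup>+z. ennreal (f z) * indicator {u<..v} z \<partial>lborel)" for u v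
    by (subst D_eq, subst emeasure_density) auto
  have lower: "k * (v - u) \<le> S u - S v"
    if "u \<le> v" "0 \<le> k" and k: "\<And>z. u < z \<Longrightarrow> z \<le> v \<Longrightarrow> k \<le> f z" for u v k
  proof -
    have "ennreal (k * (v - u)) = (\<integral>\<^sup>+z. ennreal k * indicator {u<..v} z \<partial>lborel)"
      using that by (simp add: nn_integral_cmult_indicator ennreal_mult)
    also have "\<dots> \<le> emeasure D {u<..v}" unfolding emeasure_Ioc
      by (intro nn_integral_mono) (auto simp: indicator_def intro!: ennreal_leI k)
    also have "\<dots> = ennreal (S u - S v)"
      by (simp add: emeasure_eq_measure survival_diff[OF that(1)] S_def)
    finally show ?thesis using S_mono[OF that(1)] by (subst (asm) ennreal_le_iff) auto
  qed
  have upper: "S u - S v \<le> k * (v - u)"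
    if "u \<le> v" "0 \<le> k" and k: "\<And>z. u < z \<Longrightarrow> z \<le> v \<Longrightarrow> f z \<le> k" for u v k
  proof -
    have "ennreal (S u - S v) = emeasure D {u<..v}"
      by (simp add: emeasure_eq_measure survival_diff[OF that(1)] S_def)
    also have "\<dots> \<le> (\<integral>\<^sup>+z. ennreal k * indicator {u<..v} z \<partial>lborel)" unfolding emeasure_Ioc
      by (intro nn_integral_mono) (auto simp: indicator_def intro!: ennreal_leI k)
    also have "\<dots> = ennreal (k * (v - u))"
      using that by (simp add: nn_integral_cmult_indicator ennreal_mult)
    finally show ?thesis using that(1,2) by (subst (asm) ennreal_le_iff) auto
  qed
  have right: "S x * exp (h y * (x - y)) \<le> S y"
  proof (rule exp_step_bound[OF \<open>y \<le> x\<close>])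
    fix u v assume uv: "y \<le> u" "u \<le> v" "v \<le> x"
    \<comment> \<open>On \<open>{u<..v}\<close> the density \<open>h z * S z\<close> is at least
      \<open>h y * S v\<close>, as \<open>h\<close> increases and \<open>S\<close>
      decreases.\<close>
    have "h y * S v * (v - u) \<le> S u - S v"
      using uv by (intro lower) (auto simp: f_eq h_nonneg S_nonneg intro!: mult_mono h_mono S_mono)
    thus "S v * (1 + h y * (v - u)) \<le> S u" by (simp add: algebra_simps)
  qed
  have left: "1 \<le> S y * exp (h y * y)"
  proof -
    have cdf0: "cdf D 0 = 0" by (rule is_pdf_cdf_0[OF D f assms(2)])
    \<comment> \<open>The step bound yields a lower bound at the left end point; reflecting
      \<open>S\<close> turns it into one at \<open>y\<close>, with the negative rate
      \<open>- h y\<close>.\<close>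
    define R where "R = (\<lambda>z. S (- z))"
    have "R (- 0) * exp (- h y * (- 0 - - y)) \<le> R (- y)"
    proof (rule exp_step_bound)
      fix u v :: real assume uv: "- y \<le> u" "u \<le> v" "v \<le> - 0"
      have "S (- v) - S (- u) \<le> h y * S (- v) * (- u - - v)"
        using uv \<open>y \<le> x\<close>
        by (intro upper) (auto simp: f_eq h_nonneg S_nonneg intro!: mult_mono h_mono S_mono)
      thus "R v * (1 + - h y * (v - u)) \<le> R u" by (simp add: R_def algebra_simps)
    qed (use \<open>0 \<le> y\<close> in simp)
    hence "exp (- (h y * y)) \<le> S y" using cdf0 by (simp add: R_def S_def)
    thus ?thesis by (simp add: exp_minus field_simps)
  qed
  show ?thesis
  \<comment> \<open>If the exponential decays no faster than the supporting line, the bound is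
    carried back from \<open>x\<close>; otherwise it is carried forward from the value 1 at
    0.\<close>
  proof (cases "c \<le> h y")
    case True
    have "exp (- c * y) = exp (- c * x) * exp (c * (x - y))"
      by (simp add: exp_add[symmetric] algebra_simps)
    also have "\<dots> \<le> S x * exp (h y * (x - y))"
      using assms(4,5) True by (intro mult_mono) (auto simp: S_def mult_right_mono cdf_bounded_prob)
    also have "\<dots> \<le> S y" by (rule right)
    finally show ?thesis by (simp add: S_def)
  next
    case False
    have "exp (- c * y) \<le> exp (- c * y) * (S y * exp (h y * y))"
      using left by simp
    also have "\<dots> = S y * exp ((h y - c) * y)"
      by (simp add: exp_add[symmetric] algebra_simps)
    also have "\<dots> \<le> S y * 1"
      using False \<open>0 \<le> y\<close> by (intro mult_left_mono S_nonneg) (auto simp: mult_le_0_iff)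
    finally show ?thesis by (simp add: S_def)
  qed
qed

section \<open>Layer cake and comparison with the exponential distribution\<close>

text \<open>Tonelli on the region \<open>0 \<le> x < Y\<close>. For nonnegative \<open>Y\<close> the
  weight 1 gives the mean, and the weight \<open>s * exp (s * x)\<close> gives the exponential
  moment minus 1.\<close>

lemma (in prob_space) nn_integral_layer_cake:
  fixes \<phi> :: "real \<Rightarrow> ennreal"
  assumes [measurable]: "Y \<in> borel_measurable M" "\<phi> \<in> borel_measurable borel"
  shows "(\<integral>\<^sup>+\<omega>. (\<integral>\<^sup>+x. \<phi> x * indicator {0..<Y \<omega>} x \<partial>lborel) \<partial>M) =
         (\<integral>\<^sup>+x. \<phi> x * ennreal (prob {\<omega>\<in>space M. x < Y \<omega>}) * indicator {0..} x \<partial>lborel)"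
proof -
  interpret pair_sigma_finite M lborel ..
  have "(\<integral>\<^sup>+\<omega>. (\<integral>\<^sup>+x. \<phi> x * indicator {0..<Y \<omega>} x \<partial>lborel) \<partial>M) =
        (\<integral>\<^sup>+\<omega>. (\<integral>\<^sup>+x. (if 0 \<le> x \<and> x < Y \<omega> then \<phi> x else 0) \<partial>lborel) \<partial>M)"
    by (intro nn_integral_cong) (auto simp: indicator_def)
  also have "\<dots> = (\<integral>\<^sup>+x. (\<integral>\<^sup>+\<omega>. (if 0 \<le> x \<and> x < Y \<omega> then \<phi> x else 0) \<partial>M) \<partial>lborel)"
    by (rule Fubini'[symmetric]) measurable
  also have "\<dots> = (\<integral>\<^sup>+x. (\<integral>\<^sup>+\<omega>. \<phi> x * indicator {0..} x * indicator {\<omega>\<in>space M. x < Y \<omega>} \<omega> \<partial>M) \<partial>lborel)"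
    by (intro nn_integral_cong) (auto simp: indicator_def)
  also have "\<dots> = (\<integral>\<^sup>+x. \<phi> x * ennreal (prob {\<omega>\<in>space M. x < Y \<omega>}) * indicator {0..} x \<partial>lborel)"
    by (intro nn_integral_cong, subst nn_integral_cmult_indicator)
       (auto simp: emeasure_eq_measure mult_ac)
  finally show ?thesis .
qed

lemma nn_integral_exp_Ici:
  assumes "0 < c"
  shows "(\<integral>\<^sup>+x. ennreal (exp (- c * x)) * indicator {0..} x \<partial>lborel) = ennreal (1 / c)"
proof -
  have "(\<integral>\<^sup>+x. ennreal (exp (- c * x)) * indicator {0..} x \<partial>lborel) = ennreal (0 - (- exp (- c * 0) / c))"
  proof (rule nn_integral_FTC_atLeast)
    show "((\<lambda>x. - exp (- c * x) / c) has_real_derivative exp (- c * x)) (at x)" for x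
      using assms by (auto intro!: derivative_eq_intros)
    show "((\<lambda>x. - exp (- c * x) / c) \<longlongrightarrow> 0) at_top"
      using assms by real_asymp
  qed auto
  thus ?thesis by simp
qed

text \<open>
  The function \<open>G - E\<close>, where \<open>E\<close> is the exponential with the same integral, changes sign at most once,
  at some \<open>a\<close>, from positive to negative. Hence \<open>(\<phi> x - \<phi> a) (G x - E x) \<le> 0\<close>, and integrating this
  removes \<open>\<phi> a\<close>.
\<close>

lemma nn_integral_exponential_domination:
  fixes G \<phi> :: "real \<Rightarrow> real"
  assumes [measurable]: "G \<in> borel_measurable borel" "\<phi> \<in> borel_measurable borel"
    and G: "\<And>x. 0 \<le> G x"
    and star: "\<And>c x y. 0 \<le> y \<Longrightarrow> y \<le> x \<Longrightarrow> exp (- c * x) \<le> G x \<Longrightarrow> exp (- c * y) \<le> G y"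
    and mean: "(\<integral>\<^sup>+x. ennreal (G x) * indicator {0..} x \<partial>lborel) = ennreal \<mu>" "0 < \<mu>"
    and \<phi>: "\<And>x. 0 \<le> \<phi> x" "mono \<phi>"
  shows "(\<integral>\<^sup>+x. ennreal (\<phi> x * G x) * indicator {0..} x \<partial>lborel)
           \<le> (\<integral>\<^sup>+x. ennreal (\<phi> x * exp (- (1 / \<mu>) * x)) * indicator {0..} x \<partial>lborel)"
proof -
  define E where "E = (\<lambda>x. exp (- (1 / \<mu>) * x))"
  have [measurable]: "E \<in> borel_measurable borel" by (simp add: E_def)
  have E_pos: "0 < E x" for x by (simp add: E_def)
  have E_int: "(\<integral>\<^sup>+x. ennreal (E x) * indicator {0..} x \<partial>lborel) = ennreal \<mu>"
    unfolding E_def using mean(2) by (subst nn_integral_exp_Ici) auto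
  have down: "E y \<le> G y" if "0 \<le> y" "y \<le> x" "E x \<le> G x" for x y
    using star[OF that(1,2), of "1 / \<mu>"] that(3) by (simp add: E_def)
  \<comment> \<open>By \<open>down\<close> this set is an initial segment of the half-line; its end
    point is the crossing.\<close>
  define K where "K = {x. 0 \<le> x \<and> E x \<le> G x}"
  show ?thesis
  proof (cases "\<exists>z\<ge>0. z \<notin> K")
    case True
    then obtain z where z: "0 \<le> z" "z \<notin> K" by blast
    have K_le: "x < z" if "x \<in> K" for x
      using down[OF z(1), of x] z that by (force simp: K_def not_less)
    \<comment> \<open>For empty \<open>K\<close> the value 0 makes \<open>below\<close> vacuous.
      Whether \<open>a\<close> itself lies in \<open>K\<close> is immaterial, since
      \<open>\<phi> a - \<phi> x\<close> vanishes at \<open>x = a\<close>.\<close>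
    define a where "a = (if K = {} then 0 else Sup K)"
    have bdd: "bdd_above K" using K_le by (auto intro!: bdd_aboveI[of _ z] less_imp_le)
    have above: "x \<le> a" if "x \<in> K" for x
      using that bdd by (auto simp: a_def intro: cSup_upper)
    have below: "x \<in> K" if "0 \<le> x" "x < a" for x
    proof -
      from that have "K \<noteq> {}" "x < Sup K" by (auto simp: a_def split: if_splits)
      then obtain w where "w \<in> K" "x < w" using less_cSup_iff[OF _ bdd] by blast
      thus ?thesis using down[OF \<open>0 \<le> x\<close>, of w] that by (auto simp: K_def)
    qed
    \<comment> \<open>The sign condition is rearranged into sums of nonnegative terms, because
      subtraction in \<open>ennreal\<close> truncates.\<close>
    have crossing: "\<phi> x * G x + \<phi> a * E x \<le> \<phi> x * E x + \<phi> a * G x" if "0 \<le> x" for x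
    proof -
      have "0 \<le> (\<phi> a - \<phi> x) * (G x - E x)"
      proof (cases x a rule: linorder_cases)
        case less
        hence "E x \<le> G x" using below that by (auto simp: K_def)
        thus ?thesis using less \<phi>(2) by (intro mult_nonneg_nonneg) (auto simp: monoD)
      next
        case greater
        hence "G x \<le> E x" using above[of x] that by (force simp: K_def)
        thus ?thesis using greater \<phi>(2) by (intro mult_nonpos_nonpos) (auto simp: monoD)
      qed simp
      thus ?thesis by (simp add: algebra_simps)
    qed
    have split: "(\<integral>\<^sup>+x. ennreal (\<phi> x * P x + \<phi> a * Q x) * indicator {0..} x \<partial>lborel) =
        (\<integral>\<^sup>+x. ennreal (\<phi> x * P x) * indicator {0..} x \<partial>lborel) + ennreal (\<phi> a) * ennreal \<mu>"
      if [measurable]: "P \<in> borel_measurable borel" "Q \<in> borel_measurable borel"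
      and "\<And>x. 0 \<le> P x" "\<And>x. 0 \<le> Q x"
      and Q: "(\<integral>\<^sup>+x. ennreal (Q x) * indicator {0..} x \<partial>lborel) = ennreal \<mu>" for P Q
      unfolding Q[symmetric] using that \<phi>(1)
      by (subst nn_integral_cmult[symmetric], measurable, subst nn_integral_add[symmetric])
         (auto intro!: nn_integral_cong simp: indicator_def ennreal_plus ennreal_mult)
    have "(\<integral>\<^sup>+x. ennreal (\<phi> x * G x + \<phi> a * E x) * indicator {0..} x \<partial>lborel)
        \<le> (\<integral>\<^sup>+x. ennreal (\<phi> x * E x + \<phi> a * G x) * indicator {0..} x \<partial>lborel)"
      by (intro nn_integral_mono) (auto simp: indicator_def intro!: ennreal_leI crossing)
    hence "(\<integral>\<^sup>+x. ennreal (\<phi> x * G x) * indicator {0..} x \<partial>lborel) + ennreal (\<phi> a) * ennreal \<mu>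
         \<le> (\<integral>\<^sup>+x. ennreal (\<phi> x * E x) * indicator {0..} x \<partial>lborel) + ennreal (\<phi> a) * ennreal \<mu>"
      using E_pos by (subst (asm) (1 2) split) (auto simp: G E_int mean less_imp_le)
    \<comment> \<open>The common summand \<open>ennreal (\<phi> a) * ennreal \<mu>\<close> is finite
      and may be cancelled.\<close>
    thus ?thesis
      unfolding E_def by (subst (asm) (1 2) add.commute, subst (asm) ennreal_add_left_cancel_le)
        (auto simp: ennreal_mult_eq_top_iff)
  next
    case False
    \<comment> \<open>Without a crossing \<open>E\<close> lies below \<open>G\<close> throughout; as
      the integrals agree and are finite, the two coincide almost everywhere on the
      half-line.\<close>
    hence le: "E x \<le> G x" if "0 \<le> x" for x using that by (auto simp: K_def)
    have mono: "ennreal (E x) * indicator {0..} x \<le> ennreal (G x) * indicator {0..} x" for x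
      by (auto simp: indicator_def intro!: ennreal_leI le)
    have "(\<integral>\<^sup>+x. (ennreal (G x) * indicator {0..} x - ennreal (E x) * indicator {0..} x) \<partial>lborel)
        = ennreal \<mu> - ennreal \<mu>"
    proof (subst nn_integral_diff)
      show "AE x in lborel. ennreal (E x) * indicator {0..} x \<le> ennreal (G x) * indicator {0..} x"
        using mono by blast
    qed (measurable, simp_all only: mean E_int ennreal_neq_top infinity_ennreal_def not_False_eq_True)
    hence "AE x in lborel. ennreal (G x) * indicator {0..} x - ennreal (E x) * indicator {0..} x = 0"
      by (subst (asm) ennreal_diff_self, simp, subst (asm) nn_integral_0_iff_AE) measurable
    hence "AE x in lborel. ennreal (\<phi> x * G x) * indicator {0..} x
                         = ennreal (\<phi> x * E x) * indicator {0..} x"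
    proof eventually_elim
      case (elim x)
      hence "G x = E x" if "0 \<le> x"
        using le[OF that] that E_pos[of x] by (auto simp: ennreal_minus ennreal_eq_0_iff)
      thus ?case by (auto simp: indicator_def)
    qed
    hence "(\<integral>\<^sup>+x. ennreal (\<phi> x * G x) * indicator {0..} x \<partial>lborel)
         = (\<integral>\<^sup>+x. ennreal (\<phi> x * E x) * indicator {0..} x \<partial>lborel)"
      by (rule nn_integral_cong_AE)
    thus ?thesis by (simp add: E_def)
  qed
qed

text \<open>Once \<open>S a < 1\<close> for some \<open>a > 0\<close>, star-shapedness forces an
  exponential tail: a survival probability above \<open>exp (- c * x)\<close> beyond
  \<open>a\<close> would push \<open>S a\<close> up to at least \<open>exp (- c * a)\<close>.
  Integrability of the minima and of the optimum rests on this.\<close>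

lemma MHR_integrable:
  assumes "continuous_MHR D" "AE x in D. 0 \<le> x"
  shows "integrable D (\<lambda>x. x)"
proof -
  interpret real_distribution D using assms(1) by (simp add: continuous_MHR_def)
  define S where "S = (\<lambda>x. 1 - cdf D x)"
  have S_le: "S x \<le> 1" for x by (simp add: S_def cdf_nonneg)
  have S_nonneg: "0 \<le> S x" for x by (simp add: S_def cdf_bounded_prob)
  have S_eq: "S x = prob {y\<in>space D. x < y}" for x
  proof -
    have "{y\<in>space D. x < y} = space D - {..x}" by auto
    thus ?thesis using prob_compl[of "{..x}"] by (simp add: S_def cdf_def)
  qed
  have "\<forall>\<^sub>F a in at_top. 0 < cdf D a \<and> 0 < a"
    using order_tendstoD(1)[OF cdf_lim_at_top_prob, of 0] by (auto intro: eventually_conj eventually_gt_at_top)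
  then obtain a where a: "0 < cdf D a" "0 < a"
    using eventually_happens'[OF trivial_limit_at_top_linorder] by blast
  \<comment> \<open>The midpoint lies strictly between \<open>S a\<close> and 1, so the rate
    \<open>c\<close> is positive and well defined even if \<open>S a = 0\<close>.\<close>
  define q where "q = (1 + S a) / 2"
  have q: "S a < q" "0 < q" "q < 1" using a(1) S_nonneg[of a] by (auto simp: q_def S_def)
  define c where "c = - ln q / a"
  have c: "0 < c" "exp (- c * a) = q" using q a(2) by (auto simp: c_def divide_neg_pos)
  have tail: "S x \<le> exp (- c * x)" if "a \<le> x" for x
  proof (rule ccontr)
    assume "\<not> S x \<le> exp (- c * x)"
    hence "exp (- c * a) \<le> S a"
      using MHR_survival_star_shaped[OF assms, of a x c] a(2) that by (simp add: S_def)
    thus False using c(2) q(1) by simp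
  qed
  have "(\<integral>\<^sup>+x. ennreal (norm x) \<partial>D) = (\<integral>\<^sup>+x. (\<integral>\<^sup>+z. 1 * indicator {0..<x} z \<partial>lborel) \<partial>D)"
    using assms(2) by (intro nn_integral_cong_AE, eventually_elim) auto
  also have "\<dots> = (\<integral>\<^sup>+z. 1 * ennreal (prob {y\<in>space D. z < y}) * indicator {0..} z \<partial>lborel)"
    by (rule nn_integral_layer_cake) auto
  also have "\<dots> = (\<integral>\<^sup>+z. ennreal (S z) * indicator {0..} z \<partial>lborel)"
    unfolding S_eq by simp
  also have "\<dots> \<le> (\<integral>\<^sup>+z. indicator {0..a} z + ennreal (exp (- c * z)) * indicator {0..} z \<partial>lborel)"
  proof (intro nn_integral_mono)
    fix z :: real
    show "ennreal (S z) * indicator {0..} z \<le> indicator {0..a} z + ennreal (exp (- c * z)) * indicator {0..} z"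
    proof (cases "z \<le> a")
      case True
      have "ennreal (S z) \<le> 1" using S_le[of z] by simp
      with True show ?thesis by (auto simp: indicator_def intro!: add_increasing2)
    next
      case False
      thus ?thesis using tail[of z] by (auto simp: indicator_def intro: ennreal_leI)
    qed
  qed
  also have "\<dots> = ennreal a + ennreal (1 / c)"
    using a(2) c(1) by (subst nn_integral_add) (auto simp: nn_integral_exp_Ici[simplified])
  also have "\<dots> < \<infinity>" by simp
  finally show ?thesis by (intro integrableI_bounded) auto
qed

section \<open>The minimum of finitely many i.i.d. MHR variables\<close>

context
  fixes D :: "real measure" and I :: "'i set"
  assumes MHR: "continuous_MHR D" and nonneg: "AE x in D. 0 \<le> x"
    and I: "finite I" "I \<noteq> {}"
begin

interpretation D: real_distribution D
  using MHR by (simp add: continuous_MHR_def)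

interpretation P: finite_product_prob_space "\<lambda>_. D" I
  by standard (rule I(1))

lemma Min_component_measurable [measurable]:
  "(\<lambda>x. Min (x ` I)) \<in> borel_measurable (Pi\<^sub>M I (\<lambda>_. D))"
  by (rule borel_measurable_Min[OF I(1)]) simp

text \<open>The event is a box. The survival function of the minimum is thus a power of that of
  \<open>D\<close> and inherits star-shapedness.\<close>

lemma prob_less_Min:
  "P.prob {x\<in>space (Pi\<^sub>M I (\<lambda>_. D)). u < Min (x ` I)} = (1 - cdf D u) ^ card I"
proof -
  have "{x\<in>space (Pi\<^sub>M I (\<lambda>_. D)). u < Min (x ` I)} = (\<Pi>\<^sub>E i\<in>I. {u<..})"
    using I by (auto simp: space_PiM PiE_iff extensional_def)
  hence "P.prob {x\<in>space (Pi\<^sub>M I (\<lambda>_. D)). u < Min (x ` I)} = (\<Prod>i\<in>I. D.prob {u<..})"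
    using I by (simp add: P.finite_measure_PiM_emb)
  moreover have "{u<..} = space D - {..u}" by auto
  hence "D.prob {u<..} = 1 - cdf D u" using D.prob_compl[of "{..u}"] by (simp add: cdf_def)
  ultimately show ?thesis by simp
qed

lemma AE_component_nonneg: "AE x in Pi\<^sub>M I (\<lambda>_. D). \<forall>i\<in>I. 0 \<le> x i"
  using I(1) nonneg by (auto intro!: AE_finite_allI AE_PiM_component D.prob_space_axioms)

lemma AE_Min_nonneg: "AE x in Pi\<^sub>M I (\<lambda>_. D). 0 \<le> Min (x ` I)"
  using AE_component_nonneg by eventually_elim (use I in auto)

lemma nn_integral_component:
  assumes "i \<in> I" "g \<in> borel_measurable D"
  shows "(\<integral>\<^sup>+x. g (x i) \<partial>Pi\<^sub>M I (\<lambda>_. D)) = (\<integral>\<^sup>+y. g y \<partial>D)"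
  using assms I(1)
  by (subst distr_PiM_component[of I "\<lambda>_. D" i, symmetric], simp_all add: D.prob_space_axioms)
     (subst nn_integral_distr, auto)

lemma Min_integrable: "integrable (Pi\<^sub>M I (\<lambda>_. D)) (\<lambda>x. Min (x ` I))"
proof (rule integrableI_bounded)
  obtain i where i: "i \<in> I" using I(2) by blast
  have "(\<integral>\<^sup>+x. ennreal (norm (Min (x ` I))) \<partial>Pi\<^sub>M I (\<lambda>_. D)) \<le> (\<integral>\<^sup>+x. ennreal (norm (x i)) \<partial>Pi\<^sub>M I (\<lambda>_. D))"
    using AE_component_nonneg AE_Min_nonneg
    by (intro nn_integral_mono_AE, eventually_elim) (use I i in \<open>auto intro!: ennreal_leI Min_le\<close>)
  also have "\<dots> = (\<integral>\<^sup>+x. ennreal (norm x) \<partial>D)" using i by (rule nn_integral_component) simp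
  also have "\<dots> < \<infinity>" using MHR_integrable[OF MHR nonneg] by (simp add: integrable_iff_bounded)
  finally show "(\<integral>\<^sup>+x. ennreal (norm (Min (x ` I))) \<partial>Pi\<^sub>M I (\<lambda>_. D)) < \<infinity>" .
qed measurable

text \<open>Layer cake with weight 1. The identity supplies the mean hypothesis of
  \<open>nn_integral_exponential_domination\<close>.\<close>

lemma nn_integral_survival_power:
  "(\<integral>\<^sup>+x. ennreal ((1 - cdf D x) ^ card I) * indicator {0..} x \<partial>lborel)
     = ennreal (P.expectation (\<lambda>x. Min (x ` I)))"
proof -
  have "ennreal (P.expectation (\<lambda>x. Min (x ` I))) = (\<integral>\<^sup>+x. ennreal (Min (x ` I)) \<partial>Pi\<^sub>M I (\<lambda>_. D))"
    by (rule nn_integral_eq_integral[symmetric, OF Min_integrable AE_Min_nonneg])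
  also have "\<dots> = (\<integral>\<^sup>+x. (\<integral>\<^sup>+z. 1 * indicator {0..<Min (x ` I)} z \<partial>lborel) \<partial>Pi\<^sub>M I (\<lambda>_. D))"
    using AE_Min_nonneg by (intro nn_integral_cong_AE, eventually_elim) simp
  also have "\<dots> = (\<integral>\<^sup>+z. ennreal ((1 - cdf D z) ^ card I) * indicator {0..} z \<partial>lborel)"
    by (subst P.nn_integral_layer_cake) (simp_all add: prob_less_Min)
  finally show ?thesis by simp
qed

text \<open>A vanishing mean would force the minimum to be 0 almost surely, whereas it exceeds 0
  with probability \<open>(1 - cdf D 0) ^ card I = 1\<close>.\<close>

lemma Min_expectation_pos: "0 < P.expectation (\<lambda>x. Min (x ` I))"
proof (rule ccontr)
  assume "\<not> ?thesis"
  moreover have ge: "0 \<le> P.expectation (\<lambda>x. Min (x ` I))"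
    by (rule integral_nonneg_AE[OF AE_Min_nonneg])
  ultimately have "P.expectation (\<lambda>x. Min (x ` I)) = 0" by simp
  hence "AE x in Pi\<^sub>M I (\<lambda>_. D). Min (x ` I) = 0"
    using integral_nonneg_eq_0_iff_AE[OF Min_integrable AE_Min_nonneg] by simp
  hence "P.prob {x\<in>space (Pi\<^sub>M I (\<lambda>_. D)). 0 < Min (x ` I)} = 0"
    by (subst P.prob_eq_0) (auto elim!: eventually_mono)
  thus False
    using is_pdf_cdf_0[OF D.real_distribution_axioms _ nonneg] MHR
    by (auto simp: prob_less_Min continuous_MHR_def)
qed

text \<open>The rate \<open>s\<close> is half the critical rate of the exponential distribution with
  the same mean. As \<open>exp (s * y) - 1\<close> is the integral of \<open>s * exp (s * x)\<close>
  over \<open>0 \<le> x < y\<close>, layer cake and exponential domination bound the moment by the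
  integral of \<open>s * exp (- s * x)\<close> over the half-line, which is 1.\<close>

lemma exp_Min_moment:
  defines "s \<equiv> 1 / (2 * P.expectation (\<lambda>x. Min (x ` I)))"
  shows "(\<integral>\<^sup>+x. ennreal (exp (s * Min (x ` I)) - 1) \<partial>Pi\<^sub>M I (\<lambda>_. D)) \<le> 1"
proof -
  let ?\<mu> = "P.expectation (\<lambda>x. Min (x ` I))"
  have s: "0 < s" using Min_expectation_pos by (simp add: s_def)
  have exp_eq: "(\<integral>\<^sup>+x. ennreal (s * exp (s * x)) * indicator {0..<y} x \<partial>lborel) = ennreal (exp (s * y) - 1)"
    if "0 \<le> y" for y
  proof -
    have "(\<integral>\<^sup>+x. ennreal (s * exp (s * x)) * indicator {0..<y} x \<partial>lborel)
        = (\<integral>\<^sup>+x. ennreal (s * exp (s * x)) * indicator {0..y} x \<partial>lborel)"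
      using AE_lborel_singleton[of y]
      by (intro nn_integral_cong_AE, eventually_elim) (auto simp: indicator_def)
    also have "\<dots> = ennreal (exp (s * y) - exp (s * 0))"
      using that s by (intro nn_integral_FTC_Icc) (auto intro!: derivative_eq_intros)
    finally show ?thesis by simp
  qed
  have [measurable]: "cdf D \<in> borel_measurable borel"
    by (intro borel_measurable_mono monoI D.cdf_nondecreasing)
  have "(\<integral>\<^sup>+x. ennreal (exp (s * Min (x ` I)) - 1) \<partial>Pi\<^sub>M I (\<lambda>_. D))
      = (\<integral>\<^sup>+x. (\<integral>\<^sup>+z. ennreal (s * exp (s * z)) * indicator {0..<Min (x ` I)} z \<partial>lborel) \<partial>Pi\<^sub>M I (\<lambda>_. D))"
    using AE_Min_nonneg by (intro nn_integral_cong_AE, eventually_elim) (simp add: exp_eq)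
  also have "\<dots> = (\<integral>\<^sup>+z. ennreal (s * exp (s * z)) * ennreal ((1 - cdf D z) ^ card I) * indicator {0..} z \<partial>lborel)"
    by (subst P.nn_integral_layer_cake) (simp_all add: prob_less_Min)
  also have "\<dots> = (\<integral>\<^sup>+z. ennreal (s * exp (s * z) * (1 - cdf D z) ^ card I) * indicator {0..} z \<partial>lborel)"
    using s by (simp add: ennreal_mult D.cdf_bounded_prob)
  also have "\<dots> \<le> (\<integral>\<^sup>+z. ennreal (s * exp (s * z) * exp (- (1 / ?\<mu>) * z)) * indicator {0..} z \<partial>lborel)"
  proof (rule nn_integral_exponential_domination)
    show "exp (- c * y) \<le> (1 - cdf D y) ^ card I"
      if xy: "0 \<le> y" "y \<le> x" and le: "exp (- c * x) \<le> (1 - cdf D x) ^ card I" for c x y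
    proof -
      have pos: "0 < card I" using I by (simp add: card_gt_0_iff)
      \<comment> \<open>Taking roots reduces the claim to a single variable: rate \<open>c\<close>
        for the power is rate \<open>c / card I\<close> for \<open>1 - cdf D\<close>.\<close>
      have eq: "exp (- c * z) = exp (- (c / card I) * z) ^ card I" for z
        using pos by (simp add: exp_of_nat_mult[symmetric])
      have "exp (- (c / card I) * x) \<le> 1 - cdf D x"
        using le pos unfolding eq by (subst (asm) power_mono_iff) (auto simp: D.cdf_bounded_prob)
      hence "exp (- (c / card I) * y) \<le> 1 - cdf D y"
        by (rule MHR_survival_star_shaped[OF MHR nonneg xy])
      thus ?thesis unfolding eq by (intro power_mono) auto
    qed
    show "mono (\<lambda>z. s * exp (s * z))" using s by (auto intro!: monoI)
  qed (use s Min_expectation_pos in \<open>auto simp: D.cdf_bounded_prob nn_integral_survival_power[simplified]\<close>)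
  also have "\<dots> = (\<integral>\<^sup>+z. ennreal s * (ennreal (exp (- s * z)) * indicator {0..} z) \<partial>lborel)"
  proof (intro nn_integral_cong)
    fix z
    \<comment> \<open>The choice of \<open>s\<close> means
      \<open>1 / ?\<mu> = 2 * s\<close>.\<close>
    have "s * z + - (1 / ?\<mu>) * z = - s * z" by (simp add: s_def field_simps)
    hence "s * exp (s * z) * exp (- (1 / ?\<mu>) * z) = s * exp (- s * z)"
      by (simp only: mult.assoc exp_add[symmetric])
    thus "ennreal (s * exp (s * z) * exp (- (1 / ?\<mu>) * z)) * indicator {0..} z
        = ennreal s * (ennreal (exp (- s * z)) * indicator {0..} z)"
      using s by (simp add: ennreal_mult mult.assoc)
  qed
  also have "\<dots> = ennreal s * ennreal (1 / s)"
    by (subst nn_integral_cmult, measurable, subst nn_integral_exp_Ici[OF s]) simp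
  also have "\<dots> = 1" using s by (simp flip: ennreal_mult)
  finally show ?thesis .
qed

end

subsection \<open>Makespans of the VCG and the optimal allocation\<close>

text \<open>
  The probability that VCG assigns a task with processing times \<open>x\<close> to machine \<open>i\<close>.
\<close>

definition tie_share :: "'i set \<Rightarrow> 'i \<Rightarrow> ('i \<Rightarrow> real) \<Rightarrow> real" where
  "tie_share I i x = of_bool (x i = Min (x ` I)) / card {k\<in>I. x k = Min (x ` I)}"

lemma card_minimizers_pos:
  assumes "finite I" "I \<noteq> {}"
  shows "0 < card {k\<in>I. (x k :: real) = Min (x ` I)}"
proof -
  have "Min (x ` I) \<in> x ` I" using assms by (intro Min_in) auto
  then obtain k where "k \<in> {k\<in>I. x k = Min (x ` I)}" by fastforce
  thus ?thesis using assms(1) by (subst card_gt_0_iff) auto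
qed

lemma tie_share_nonneg: "0 \<le> tie_share I i x"
  by (simp add: tie_share_def)

lemma tie_share_le_1: "tie_share I i x \<le> 1"
  by (cases "card {k\<in>I. x k = Min (x ` I)} = 0") (auto simp: tie_share_def field_simps)

lemma sum_tie_share:
  assumes "finite I" "I \<noteq> {}"
  shows "(\<Sum>i\<in>I. tie_share I i x) = 1"
proof -
  have "(\<Sum>i\<in>I. of_bool (x i = Min (x ` I))) = real (card {k\<in>I. x k = Min (x ` I)})"
    using assms(1) by (simp add: sum_of_bool_eq Int_def)
  thus ?thesis
    using card_minimizers_pos[OF assms, of x] by (simp only: tie_share_def sum_divide_distrib[symmetric]) simp
qed

lemma tie_share_measurable [measurable]:
  assumes "finite I" "i \<in> I" "sets D = sets borel"
  shows "tie_share I i \<in> borel_measurable (Pi\<^sub>M I (\<lambda>_. D))"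
proof -
  have comp: "(\<lambda>x. x k) \<in> borel_measurable (Pi\<^sub>M I (\<lambda>_. D))" if "k \<in> I" for k
    using measurable_component_singleton[OF that, of "\<lambda>_. D"] assms(3)
    by (simp cong: measurable_cong_sets)
  have [measurable]: "(\<lambda>x. Min (x ` I)) \<in> borel_measurable (Pi\<^sub>M I (\<lambda>_. D))"
    by (rule borel_measurable_Min[OF assms(1) comp])
  have [measurable]: "(\<lambda>x. of_bool (x k = Min (x ` I)) :: real) \<in> borel_measurable (Pi\<^sub>M I (\<lambda>_. D))"
    if "k \<in> I" for k
    unfolding of_bool_def using comp[OF that] by measurable
  \<comment> \<open>Writing the number of minimizers as a sum of indicators makes it visibly
    measurable.\<close>
  have "tie_share I i = (\<lambda>x. of_bool (x i = Min (x ` I)) / (\<Sum>k\<in>I. of_bool (x k = Min (x ` I))))"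
    using assms(1) by (simp add: tie_share_def fun_eq_iff sum_of_bool_eq Int_def)
  thus ?thesis using assms(2) by simp
qed

text \<open>Swapping two coordinates only permutes the minimizers, so the minimum and the number of
  ties survive. This symmetry makes all machines equally likely to receive a task.\<close>

lemma tie_share_transpose:
  assumes "i \<in> I" "k \<in> I"
  shows "tie_share I i (\<lambda>l\<in>I. x (Transposition.transpose i k l)) = tie_share I k x"
    and "Min ((\<lambda>l\<in>I. x (Transposition.transpose i k l)) ` I) = Min (x ` I)"
proof -
  have im: "Transposition.transpose i k ` I = I" using assms by simp
  have T: "Transposition.transpose i k l \<in> I" if "l \<in> I" for l
    using that assms by (auto simp: Transposition.transpose_def)
  show min: "Min ((\<lambda>l\<in>I. x (Transposition.transpose i k l)) ` I) = Min (x ` I)"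
    by (rule arg_cong[where f = Min]) (subst (2) im[symmetric], simp add: image_image)
  have "Transposition.transpose i k ` {l\<in>I. x (Transposition.transpose i k l) = Min (x ` I)} = {l\<in>I. x l = Min (x ` I)}"
    (is "_ ` ?A = ?B")
  proof (intro equalityI subsetI)
    fix l assume "l \<in> ?B"
    hence "Transposition.transpose i k l \<in> ?A" using T by simp
    thus "l \<in> Transposition.transpose i k ` ?A"
      by (metis image_eqI transpose_involutory)
  next
    fix l assume "l \<in> Transposition.transpose i k ` ?A"
    then obtain r where "r \<in> ?A" "l = Transposition.transpose i k r" by (rule imageE)
    thus "l \<in> ?B" using T by simp
  qed
  with card_image[OF inj_on_transpose[of i k ?A]] have "card ?A = card ?B" by (simp only:)
  moreover have "{l\<in>I. (\<lambda>l\<in>I. x (Transposition.transpose i k l)) l = Min (x ` I)} = ?A" by auto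
  ultimately show "tie_share I i (\<lambda>l\<in>I. x (Transposition.transpose i k l)) = tie_share I k x"
    unfolding tie_share_def min using assms(1) by simp
qed

text \<open>Exchangeability makes the integrals for all \<open>i\<close> equal, and the shares sum
  to 1, ties included; the share thus acts like an independent factor of mean
  \<open>1 / card I\<close>. Multiplying by \<open>card I\<close> avoids division in
  \<open>ennreal\<close>.\<close>

lemma nn_integral_tie_share:
  assumes I: "finite I" "I \<noteq> {}" "i \<in> I" and D: "real_distribution D"
    and [measurable]: "\<psi> \<in> borel_measurable borel"
  shows "of_nat (card I) * (\<integral>\<^sup>+x. ennreal (tie_share I i x * \<psi> (Min (x ` I))) \<partial>Pi\<^sub>M I (\<lambda>_. D))
       = (\<integral>\<^sup>+x. ennreal (\<psi> (Min (x ` I))) \<partial>Pi\<^sub>M I (\<lambda>_. D))"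
proof -
  interpret D: real_distribution D by fact
  have [measurable]: "(\<lambda>x. Min (x ` I)) \<in> borel_measurable (Pi\<^sub>M I (\<lambda>_. D))"
    by (rule borel_measurable_Min[OF I(1)]) simp
  have share [measurable]: "tie_share I k \<in> borel_measurable (Pi\<^sub>M I (\<lambda>_. D))" if "k \<in> I" for k
    using I(1) that by (rule tie_share_measurable) simp
  let ?A = "\<lambda>i. \<integral>\<^sup>+x. ennreal (tie_share I i x * \<psi> (Min (x ` I))) \<partial>Pi\<^sub>M I (\<lambda>_. D)"
  have eq: "?A i = ?A k" if k: "k \<in> I" for k
  proof -
    let ?T = "\<lambda>x. \<lambda>l\<in>I. x (Transposition.transpose i k l)"
    have T: "Transposition.transpose i k l \<in> I" if "l \<in> I" for l
      using that I(3) k by (auto simp: Transposition.transpose_def)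
    \<comment> \<open>An i.i.d. product measure is invariant under permutations of the
      coordinates.\<close>
    have "distr (Pi\<^sub>M I (\<lambda>_. D)) (Pi\<^sub>M I (\<lambda>_. D)) ?T = Pi\<^sub>M I (\<lambda>_. D)"
      using T by (intro distr_PiM_reindex) (auto simp: D.prob_space_axioms intro: inj_on_subset[OF inj_transpose])
    hence "?A i = (\<integral>\<^sup>+x. ennreal (tie_share I i x * \<psi> (Min (x ` I)))
        \<partial>distr (Pi\<^sub>M I (\<lambda>_. D)) (Pi\<^sub>M I (\<lambda>_. D)) ?T)" by simp
    also have "\<dots> = (\<integral>\<^sup>+x. ennreal (tie_share I i (?T x) * \<psi> (Min (?T x ` I))) \<partial>Pi\<^sub>M I (\<lambda>_. D))"
      using share[OF I(3)] T by (intro nn_integral_distr measurable_restrict measurable_component_singleton) auto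
    also have "\<dots> = ?A k" by (simp only: tie_share_transpose[OF I(3) k])
    finally show ?thesis .
  qed
  have "of_nat (card I) * ?A i = (\<Sum>k\<in>I. ?A k)"
    using sum.cong[OF refl eq, of I "\<lambda>k. k"] by simp
  also have "\<dots> = (\<integral>\<^sup>+x. (\<Sum>k\<in>I. ennreal (tie_share I k x * \<psi> (Min (x ` I)))) \<partial>Pi\<^sub>M I (\<lambda>_. D))"
    using share by (intro nn_integral_sum[symmetric]) auto
  also have "\<dots> = (\<integral>\<^sup>+x. ennreal (\<psi> (Min (x ` I))) \<partial>Pi\<^sub>M I (\<lambda>_. D))"
    by (simp add: ennreal_mult' tie_share_nonneg sum_distrib_right[symmetric] sum_ennreal
        sum_tie_share[OF I(1,2)])
  finally show ?thesis .
qed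

section \<open>Exponential moments of the machine loads\<close>

text \<open>Finite support makes every real function of the allocation integrable.\<close>

lemma finite_set_VCG_allocation:
  assumes "1 \<le> n"
  shows "finite (set_pmf (VCG_allocation n m t))"
proof -
  have "fastest_machines n t j \<noteq> {} \<and> finite (fastest_machines n t j)" for j
    using card_minimizers_pos[of "{1..n}" "\<lambda>i. t i j"] assms
    by (auto simp: fastest_machines_def card_gt_0_iff)
  thus ?thesis unfolding VCG_allocation_def
    by (subst set_Pi_pmf) (auto intro!: finite_PiE_dflt)
qed

text \<open>For fixed processing times the tie-breaking choices are independent across tasks, so the
  expectation factors. Task \<open>j\<close> contributes \<open>exp (s * t i j)\<close> with
  probability equal to its tie share and 1 otherwise.\<close>

lemma expectation_exp_load:
  assumes "1 \<le> n" "i \<in> {1..n}"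
  shows "measure_pmf.expectation (VCG_allocation n m t) (\<lambda>a. exp (s * (\<Sum>j\<in>{j\<in>{1..m}. a j = i}. t i j)))
    = (\<Prod>j\<in>{1..m}. 1 + tie_share {1..n} i (\<lambda>i. t i j) * (exp (s * Min ((\<lambda>i. t i j) ` {1..n})) - 1))"
proof -
  have F: "fastest_machines n t j \<noteq> {}" "finite (fastest_machines n t j)" for j
    using card_minimizers_pos[of "{1..n}" "\<lambda>i. t i j"] assms
    by (auto simp: fastest_machines_def card_gt_0_iff)
  define w where "w = (\<lambda>j k. if k = i then exp (s * t i j) else 1)"
  have "exp (s * (\<Sum>j\<in>{j\<in>{1..m}. a j = i}. t i j)) = (\<Prod>j\<in>{1..m}. w j (a j))" for a
  proof -
    have "exp (s * (\<Sum>j\<in>{j\<in>{1..m}. a j = i}. t i j)) = (\<Prod>j\<in>{j\<in>{1..m}. a j = i}. exp (s * t i j))"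
      by (simp add: sum_distrib_left exp_sum)
    also have "\<dots> = (\<Prod>j\<in>{1..m}. w j (a j))"
      unfolding w_def by (rule prod.inter_filter) simp
    finally show ?thesis .
  qed
  hence "measure_pmf.expectation (VCG_allocation n m t) (\<lambda>a. exp (s * (\<Sum>j\<in>{j\<in>{1..m}. a j = i}. t i j)))
      = measure_pmf.expectation (VCG_allocation n m t) (\<lambda>a. \<Prod>j\<in>{1..m}. w j (a j))" by simp
  also have "\<dots> = (\<Prod>j\<in>{1..m}. measure_pmf.expectation (pmf_of_set (fastest_machines n t j)) (w j))"
    unfolding VCG_allocation_def
    by (rule expectation_prod_Pi_pmf) (auto simp: F w_def intro!: integrable_measure_pmf_finite)
  also have "\<dots> = (\<Prod>j\<in>{1..m}. 1 + tie_share {1..n} i (\<lambda>i. t i j) * (exp (s * Min ((\<lambda>i. t i j) ` {1..n})) - 1))"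
  proof (rule prod.cong[OF refl])
    fix j
    let ?F = "fastest_machines n t j"
    have card: "0 < card ?F" using F[of j] by (simp add: card_gt_0_iff)
    have "measure_pmf.expectation (pmf_of_set ?F) (w j) = (\<Sum>k\<in>?F. w j k) / card ?F"
      using F by (subst integral_pmf_of_set) auto
    also have "(\<Sum>k\<in>?F. w j k) = (\<Sum>k\<in>?F. 1 + (if k = i then exp (s * t i j) - 1 else 0))"
      by (intro sum.cong) (auto simp: w_def)
    also have "\<dots> = card ?F + of_bool (i \<in> ?F) * (exp (s * t i j) - 1)"
      using F by (simp add: sum.distrib)
    also have "\<dots> / card ?F = 1 + of_bool (i \<in> ?F) / card ?F * (exp (s * t i j) - 1)"
      using card by (simp add: field_simps)
    \<comment> \<open>For \<open>i \<in> ?F\<close> the time \<open>t i j\<close> is the column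
      minimum; otherwise the share is 0 and the other factor is irrelevant.\<close>
    also have "\<dots> = 1 + tie_share {1..n} i (\<lambda>i. t i j) * (exp (s * Min ((\<lambda>i. t i j) ` {1..n})) - 1)"
      using assms(2) by (auto simp: tie_share_def fastest_machines_def)
    finally show "measure_pmf.expectation (pmf_of_set ?F) (w j) = \<dots>" .
  qed
  finally show ?thesis .
qed

text \<open>
  The tangent bound \<open>ln y \<le> y - 1\<close> at \<open>y = exp (s V) / B\<close>, where \<open>V\<close> is the makespan, replaces
  Jensen's inequality for the logarithm.
\<close>

lemma VCG_le_exponential:
  fixes B s :: real
  assumes "1 \<le> n" "0 < s" "0 < B"
  shows "VCG n m t \<le> (ln B - 1 + (\<Sum>i\<in>{1..n}. \<Prod>j\<in>{1..m}.
    1 + tie_share {1..n} i (\<lambda>i. t i j) * (exp (s * Min ((\<lambda>i. t i j) ` {1..n})) - 1)) / B) / s"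
proof -
  define L where "L = (\<lambda>i a. \<Sum>j\<in>{j\<in>{1..m}. a j = i}. t i j)"
  note fin = finite_set_VCG_allocation[OF assms(1), of m t]
  have "makespan n m t a \<le> (ln B - 1 + (\<Sum>i\<in>{1..n}. exp (s * L i a)) / B) / s" for a
  proof -
    have "Max ((\<lambda>i. L i a) ` {1..n}) \<in> (\<lambda>i. L i a) ` {1..n}"
      using assms(1) by (intro Max_in) auto
    then obtain i where i: "i \<in> {1..n}" "makespan n m t a = L i a"
      by (auto simp: makespan_def L_def)
    have "ln (exp (s * L i a) / B) \<le> exp (s * L i a) / B - 1"
      using assms(3) by (intro ln_le_minus_one) simp
    hence "s * L i a \<le> ln B - 1 + exp (s * L i a) / B"
      using assms(3) by (simp add: ln_div)
    \<comment> \<open>The sum over all machines removes the dependence on the busiest one, which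
      varies with \<open>a\<close>.\<close>
    also have "exp (s * L i a) \<le> (\<Sum>i\<in>{1..n}. exp (s * L i a))"
      by (rule member_le_sum) (use i in auto)
    finally show ?thesis using i(2) assms(2,3) by (simp add: field_simps divide_right_mono)
  qed
  hence "VCG n m t \<le> measure_pmf.expectation (VCG_allocation n m t)
      (\<lambda>a. (ln B - 1 + (\<Sum>i\<in>{1..n}. exp (s * L i a)) / B) / s)"
    unfolding VCG_def using fin by (intro integral_mono integrable_measure_pmf_finite) auto
  also have "\<dots> = (ln B - 1 + (\<Sum>i\<in>{1..n}. measure_pmf.expectation (VCG_allocation n m t) (\<lambda>a. exp (s * L i a))) / B) / s"
    by (simp add: integrable_measure_pmf_finite[OF fin] measure_pmf.prob_space)
  also have "(\<Sum>i\<in>{1..n}. measure_pmf.expectation (VCG_allocation n m t) (\<lambda>a. exp (s * L i a)))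
      = (\<Sum>i\<in>{1..n}. \<Prod>j\<in>{1..m}.
          1 + tie_share {1..n} i (\<lambda>i. t i j) * (exp (s * Min ((\<lambda>i. t i j) ` {1..n})) - 1))"
    unfolding L_def by (intro sum.cong refl expectation_exp_load assms(1))
  finally show ?thesis .
qed

section \<open>Bounds for the optimal makespan\<close>

text \<open>For every assignment the total load is at least the sum of the minimal times and at most
  \<open>n\<close> times the makespan.\<close>

lemma OPT_ge_average:
  assumes "1 \<le> n"
  shows "(\<Sum>j\<in>{1..m}. Min ((\<lambda>i. t i j) ` {1..n})) / n \<le> OPT n m t"
  unfolding OPT_def
proof (subst Min_ge_iff)
  show "finite (makespan n m t ` ({1..m} \<rightarrow>\<^sub>E {1..n}))" by (intro finite_imageI finite_PiE) auto
  show "makespan n m t ` ({1..m} \<rightarrow>\<^sub>E {1..n}) \<noteq> {}" using assms by (auto simp: PiE_eq_empty_iff)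
  have "(\<Sum>j\<in>{1..m}. Min ((\<lambda>i. t i j) ` {1..n})) / n \<le> makespan n m t a" if a: "a \<in> {1..m} \<rightarrow>\<^sub>E {1..n}" for a
  proof -
    have "(\<Sum>j\<in>{1..m}. Min ((\<lambda>i. t i j) ` {1..n})) \<le> (\<Sum>j\<in>{1..m}. t (a j) j)"
      using a by (intro sum_mono Min_le) auto
    also have "\<dots> = (\<Sum>i\<in>{1..n}. \<Sum>j\<in>{j\<in>{1..m}. a j = i}. t (a j) j)"
      using a by (intro sum.group[symmetric]) auto
    also have "\<dots> = (\<Sum>i\<in>{1..n}. \<Sum>j\<in>{j\<in>{1..m}. a j = i}. t i j)"
      by (intro sum.cong) auto
    also have "\<dots> \<le> (\<Sum>i\<in>{1..n}. makespan n m t a)"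
      by (intro sum_mono) (auto simp: makespan_def intro!: Max_ge)
    finally show ?thesis using assms by (simp add: field_simps)
  qed
  thus "\<forall>y\<in>makespan n m t ` ({1..m} \<rightarrow>\<^sub>E {1..n}).
      (\<Sum>j\<in>{1..m}. Min ((\<lambda>i. t i j) ` {1..n})) / n \<le> y" by auto
qed

text \<open>Provides an integrable majorant for the optimum. Absolute values appear because the
  random times are nonnegative only almost surely.\<close>

lemma abs_OPT_le:
  assumes "1 \<le> n"
  shows "\<bar>OPT n m t\<bar> \<le> (\<Sum>i\<in>{1..n}. \<Sum>j\<in>{1..m}. \<bar>t i j\<bar>)"
proof -
  have "OPT n m t \<in> makespan n m t ` ({1..m} \<rightarrow>\<^sub>E {1..n})"
    unfolding OPT_def using assms
    by (intro Min_in) (auto simp: PiE_eq_empty_iff intro!: finite_PiE)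
  then obtain a where a: "OPT n m t = makespan n m t a" by blast
  have "makespan n m t a \<in> (\<lambda>i. \<Sum>j\<in>{j\<in>{1..m}. a j = i}. t i j) ` {1..n}"
    unfolding makespan_def using assms by (intro Max_in) auto
  then obtain i where i: "i \<in> {1..n}" "makespan n m t a = (\<Sum>j\<in>{j\<in>{1..m}. a j = i}. t i j)" by blast
  have "\<bar>OPT n m t\<bar> \<le> (\<Sum>j\<in>{j\<in>{1..m}. a j = i}. \<bar>t i j\<bar>)" unfolding a i(2) by (rule sum_abs)
  also have "\<dots> \<le> (\<Sum>j\<in>{1..m}. \<bar>t i j\<bar>)" by (intro sum_mono2) auto
  also have "\<dots> \<le> (\<Sum>i\<in>{1..n}. \<Sum>j\<in>{1..m}. \<bar>t i j\<bar>)"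
    by (rule member_le_sum) (use i in \<open>auto intro!: sum_nonneg\<close>)
  finally show ?thesis .
qed

lemma OPT_measurable [measurable]:
  assumes "\<And>i j. i \<in> {1..n} \<Longrightarrow> j \<in> {1..m} \<Longrightarrow> t i j \<in> borel_measurable M"
  shows "(\<lambda>\<omega>. OPT n m (\<lambda>i j. t i j \<omega>)) \<in> borel_measurable M"
proof -
  have "(\<lambda>\<omega>. \<Sum>j\<in>{j\<in>{1..m}. a j = i}. t i j \<omega>) \<in> borel_measurable M" if "i \<in> {1..n}" for a i
    by (rule borel_measurable_sum) (use that in \<open>auto intro: assms\<close>)
  hence "(\<lambda>\<omega>. makespan n m (\<lambda>i j. t i j \<omega>) a) \<in> borel_measurable M" for a
    unfolding makespan_def by (rule borel_measurable_Max[OF finite_atLeastAtMost])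
  thus ?thesis unfolding OPT_def
    by (rule borel_measurable_Min[rotated]) (auto intro!: finite_PiE)
qed

section \<open>Columns of processing times as independent samples\<close>

text \<open>Independence along a column makes the law indexed by the pairs
  \<open>I \<times> {j}\<close> a product; reindexing moves it to \<open>I\<close>, where the
  results on minima apply.\<close>

lemma (in prob_space) distr_iid_column:
  fixes t :: "'i \<Rightarrow> 'j \<Rightarrow> 'a \<Rightarrow> real"
  assumes ind: "indep_vars (\<lambda>_. borel) (\<lambda>(i, j). t i j) (I \<times> J)"
    and distr: "\<And>i j. i \<in> I \<Longrightarrow> j \<in> J \<Longrightarrow> distr M borel (t i j) = D"
    and D: "prob_space D" "sets D = sets borel"
    and j: "j \<in> J" and I: "I \<noteq> {}"
  shows "distr M (Pi\<^sub>M I (\<lambda>_. D)) (\<lambda>\<omega>. \<lambda>i\<in>I. t i j \<omega>) = Pi\<^sub>M I (\<lambda>_. D)"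
proof -
  let ?K = "I \<times> {j}"
  have rv: "t i k \<in> borel_measurable M" if "i \<in> I" "k \<in> J" for i k
    using ind that by (auto simp: indep_vars_def)
  have sets_D: "sets (Pi\<^sub>M A (\<lambda>_. D)) = sets (Pi\<^sub>M A (\<lambda>_. borel))" for A :: "'b set"
    using D(2) by (intro sets_PiM_cong) auto
  have "indep_vars (\<lambda>_. borel) (\<lambda>(i, j). t i j) ?K"
    by (rule indep_vars_subset[OF ind]) (use j in auto)
  hence "distr M (Pi\<^sub>M ?K (\<lambda>_. borel)) (\<lambda>\<omega>. \<lambda>p\<in>?K. (case p of (i, j) \<Rightarrow> t i j) \<omega>)
      = Pi\<^sub>M ?K (\<lambda>p. distr M borel (case p of (i, j) \<Rightarrow> t i j))"
    by (subst (asm) indep_vars_iff_distr_eq_PiM') (use I j rv in auto)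
  also have "\<dots> = Pi\<^sub>M ?K (\<lambda>_. D)" by (intro PiM_cong) (use j distr in auto)
  finally have K: "distr M (Pi\<^sub>M ?K (\<lambda>_. borel)) (\<lambda>\<omega>. \<lambda>p\<in>?K. (case p of (i, j) \<Rightarrow> t i j) \<omega>)
      = Pi\<^sub>M ?K (\<lambda>_. D)" .
  have "Pi\<^sub>M I (\<lambda>_. D) = distr (Pi\<^sub>M ?K (\<lambda>_. D)) (Pi\<^sub>M I (\<lambda>_. D)) (\<lambda>x. \<lambda>i\<in>I. x (i, j))"
    by (rule distr_PiM_reindex[symmetric]) (use D(1) in \<open>auto intro: inj_onI\<close>)
  also have "\<dots> = distr M (Pi\<^sub>M I (\<lambda>_. D)) ((\<lambda>x. \<lambda>i\<in>I. x (i, j)) \<circ>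
      (\<lambda>\<omega>. \<lambda>p\<in>?K. (case p of (i, j) \<Rightarrow> t i j) \<omega>))"
    unfolding K[symmetric]
  proof (rule distr_distr)
    show "(\<lambda>x. \<lambda>i\<in>I. x (i, j)) \<in> Pi\<^sub>M ?K (\<lambda>_. borel) \<rightarrow>\<^sub>M Pi\<^sub>M I (\<lambda>_. D)"
      by (rule measurable_restrict)
         (subst measurable_cong_sets[OF refl D(2)], auto intro: measurable_component_singleton)
    show "(\<lambda>\<omega>. \<lambda>p\<in>?K. (case p of (i, j) \<Rightarrow> t i j) \<omega>) \<in> M \<rightarrow>\<^sub>M Pi\<^sub>M ?K (\<lambda>_. borel)"
      by (rule measurable_restrict) (use rv j in auto)
  qed
  also have "(\<lambda>x. \<lambda>i\<in>I. x (i, j)) \<circ> (\<lambda>\<omega>. \<lambda>p\<in>?K. (case p of (i, j) \<Rightarrow> t i j) \<omega>)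
      = (\<lambda>\<omega>. \<lambda>i\<in>I. t i j \<omega>)"
    by (auto simp: fun_eq_iff)
  finally show ?thesis by (rule sym)
qed

text \<open>Disjoint blocks of an independent family are independent; the blocks are the columns,
  and \<open>g\<close> turns each into one variable.\<close>

lemma (in prob_space) indep_vars_columns:
  fixes t :: "'i \<Rightarrow> 'j \<Rightarrow> 'a \<Rightarrow> real"
  assumes ind: "indep_vars (\<lambda>_. borel) (\<lambda>(i, j). t i j) (I \<times> J)"
    and g: "g \<in> Pi\<^sub>M I (\<lambda>_. borel) \<rightarrow>\<^sub>M N"
  shows "indep_vars (\<lambda>_. N) (\<lambda>j \<omega>. g (\<lambda>i\<in>I. t i j \<omega>)) J"
proof -
  let ?K = "\<lambda>j. I \<times> {j}"
  have "indep_vars (\<lambda>j. Pi\<^sub>M (?K j) (\<lambda>_. borel)) (\<lambda>j \<omega>. \<lambda>p\<in>?K j. (case p of (i, j) \<Rightarrow> t i j) \<omega>) J"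
    by (rule indep_vars_restrict[OF ind]) (auto simp: disjoint_family_on_def)
  hence "indep_vars (\<lambda>_. N) (\<lambda>j \<omega>. (\<lambda>x. g (\<lambda>i\<in>I. x (i, j))) (\<lambda>p\<in>?K j. (case p of (i, j) \<Rightarrow> t i j) \<omega>)) J"
  proof (rule indep_vars_compose2)
    fix j
    show "(\<lambda>x. g (\<lambda>i\<in>I. x (i, j))) \<in> Pi\<^sub>M (?K j) (\<lambda>_. borel) \<rightarrow>\<^sub>M N"
      by (rule measurable_compose[OF measurable_restrict g]) (auto intro: measurable_component_singleton)
  qed
  moreover have "(\<lambda>i\<in>I. (\<lambda>p\<in>?K j. (case p of (i, j) \<Rightarrow> t i j) \<omega>) (i, j)) = (\<lambda>i\<in>I. t i j \<omega>)" for j \<omega>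
    by (auto simp: fun_eq_iff)
  ultimately show ?thesis by simp
qed

text \<open>Points of the product space are restricted to \<open>I\<close>, while the VCG bound
  speaks of unrestricted times; this translates between them.\<close>

lemma tie_share_restrict:
  assumes "i \<in> I"
  shows "tie_share I i (restrict x I) = tie_share I i x" "Min (restrict x I ` I) = Min (x ` I)"
proof -
  have "restrict x I ` I = x ` I" by auto
  moreover have "{k\<in>I. restrict x I k = Min (x ` I)} = {k\<in>I. x k = Min (x ` I)}" by auto
  ultimately show "tie_share I i (restrict x I) = tie_share I i x" "Min (restrict x I ` I) = Min (x ` I)"
    using assms by (simp_all add: tie_share_def)
qed

section \<open>Comparison of the expected makespans\<close>

theorem corollary6:
  fixes M :: "'w measure" and D :: "real measure"
    and t :: "nat \<Rightarrow> nat \<Rightarrow> 'w \<Rightarrow> real"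
    and n m :: nat
  assumes "prob_space M"
    and "n \<ge> 1" and "m \<ge> n" and "real m \<ge> real n * ln (real n)"
    and "continuous_MHR D" and "AE x in D. x \<ge> 0"
    and "prob_space.indep_vars M (\<lambda>_. borel) (\<lambda>(i, j). t i j) ({1..n} \<times> {1..m})"
    and "\<And>i j. i \<in> {1..n} \<Longrightarrow> j \<in> {1..m} \<Longrightarrow> distr M borel (t i j) = D"
  shows "prob_space.expectation M (\<lambda>\<omega>. VCG n m (\<lambda>i j. t i j \<omega>))
           \<le> 4 * prob_space.expectation M (\<lambda>\<omega>. OPT n m (\<lambda>i j. t i j \<omega>))"
proof -
  interpret prob_space M by fact
  interpret D: real_distribution D using assms(5) by (simp add: continuous_MHR_def)
  let ?I = "{1..n}" and ?J = "{1..m}"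
  let ?P = "Pi\<^sub>M ?I (\<lambda>_. D)"
  have I: "finite ?I" "?I \<noteq> {}" using assms(2) by auto
  define \<mu> where "\<mu> = (\<integral>x. Min (x ` ?I) \<partial>?P)"
  define s where "s = 1 / (2 * \<mu>)"
  have \<mu>: "0 < \<mu>" unfolding \<mu>_def by (rule Min_expectation_pos[OF assms(5,6) I])
  hence s: "0 < s" by (simp add: s_def)
  define col where "col = (\<lambda>j \<omega>. \<lambda>i\<in>?I. t i j \<omega>)"
  \<comment> \<open>For a task with times \<open>x\<close>, this is the factor, averaged over
    tie-breaking alone, that it contributes to the exponential moment of the load of machine
    \<open>i\<close>.\<close>
  define g where "g = (\<lambda>i x. 1 + tie_share ?I i x * (exp (s * Min (x ` ?I)) - 1))"
  define W where "W = (\<lambda>\<omega>. \<Sum>i\<in>?I. \<Prod>j\<in>?J. g i (col j \<omega>))"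
  \<comment> \<open>This will bound the mean of \<open>W\<close>: \<open>n\<close> machines, each
    with \<open>m\<close> independent factors of mean at most \<open>1 + 1 / n\<close>.\<close>
  define B where "B = real n * (1 + 1 / real n) ^ m"
  have B: "0 < B" using assms(2) by (simp add: B_def add_pos_nonneg)
  have rv [measurable]: "t i j \<in> borel_measurable M" if "i \<in> ?I" "j \<in> ?J" for i j
    using assms(7) that by (auto simp: indep_vars_def)
  have col_measurable [measurable]: "col j \<in> M \<rightarrow>\<^sub>M ?P" if "j \<in> ?J" for j
    unfolding col_def using that rv by (intro measurable_restrict) simp
  have col_distr: "distr M ?P (col j) = ?P" if "j \<in> ?J" for j
    unfolding col_def
    by (rule distr_iid_column[OF assms(7,8)]) (use that I in \<open>auto simp: D.prob_space_axioms\<close>)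
  have [measurable]: "(\<lambda>x. Min (x ` ?I)) \<in> borel_measurable ?P"
    by (rule borel_measurable_Min) simp_all
  have g_measurable [measurable]: "g i \<in> borel_measurable ?P" if "i \<in> ?I" for i
    unfolding g_def using that tie_share_measurable[of ?I i D] by simp
  have g_nonneg: "0 \<le> g i x" for i x
  proof -
    \<comment> \<open>A convex combination of 1 and an exponential, hence nonnegative for every sign
      of the minimum.\<close>
    have "0 \<le> (1 - tie_share ?I i x) + tie_share ?I i x * exp (s * Min (x ` ?I))"
      by (intro add_nonneg_nonneg mult_nonneg_nonneg) (auto simp: tie_share_nonneg tie_share_le_1)
    thus ?thesis by (simp add: g_def algebra_simps)
  qed
  have g_moment: "(\<integral>\<^sup>+x. ennreal (g i x) \<partial>?P) \<le> ennreal (1 + 1 / n)" if "i \<in> ?I" for i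
  proof -
    interpret P: prob_space ?P by (intro prob_space_PiM D.prob_space_axioms)
    have [measurable]: "tie_share ?I i \<in> borel_measurable ?P"
      using that by (intro tie_share_measurable) auto
    have "of_nat n * (\<integral>\<^sup>+x. ennreal (tie_share ?I i x * (exp (s * Min (x ` ?I)) - 1)) \<partial>?P)
        = (\<integral>\<^sup>+x. ennreal (exp (s * Min (x ` ?I)) - 1) \<partial>?P)"
      using nn_integral_tie_share[OF I that D.real_distribution_axioms, of "\<lambda>y. exp (s * y) - 1"] by simp
    also have "\<dots> \<le> 1"
      unfolding s_def \<mu>_def by (rule exp_Min_moment[OF assms(5,6) I])
    finally have "ennreal (1 / n) * (of_nat n * (\<integral>\<^sup>+x. ennreal (tie_share ?I i x * (exp (s * Min (x ` ?I)) - 1)) \<partial>?P))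
        \<le> ennreal (1 / n) * 1" by (rule mult_left_mono) simp
    moreover have "ennreal (1 / n) * of_nat n = 1"
      using assms(2) by (simp add: ennreal_of_nat_eq_real_of_nat flip: ennreal_mult)
    ultimately have le: "(\<integral>\<^sup>+x. ennreal (tie_share ?I i x * (exp (s * Min (x ` ?I)) - 1)) \<partial>?P) \<le> ennreal (1 / n)"
      by (simp flip: mult.assoc)
    \<comment> \<open>Splitting off 1 under \<open>ennreal\<close> uses that the minimum, and with
      it the second summand, is nonnegative almost surely.\<close>
    have "(\<integral>\<^sup>+x. ennreal (g i x) \<partial>?P)
        = (\<integral>\<^sup>+x. 1 + ennreal (tie_share ?I i x * (exp (s * Min (x ` ?I)) - 1)) \<partial>?P)"
      using AE_Min_nonneg[OF assms(5,6) I]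
      by (intro nn_integral_cong_AE, eventually_elim)
         (use s in \<open>simp add: g_def ennreal_plus tie_share_nonneg flip: ennreal_1\<close>)
    also have "\<dots> = 1 + (\<integral>\<^sup>+x. ennreal (tie_share ?I i x * (exp (s * Min (x ` ?I)) - 1)) \<partial>?P)"
      by (subst nn_integral_add) (auto simp: P.emeasure_space_1 simp del: One_nat_def)
    also have "\<dots> \<le> 1 + ennreal (1 / n)" by (rule add_left_mono[OF le])
    finally show ?thesis by (simp add: ennreal_plus flip: ennreal_1)
  qed
  have W_nn: "(\<integral>\<^sup>+\<omega>. ennreal (W \<omega>) \<partial>M) \<le> ennreal B"
  proof -
    have prod: "(\<integral>\<^sup>+\<omega>. (\<Prod>j\<in>?J. ennreal (g i (col j \<omega>))) \<partial>M) \<le> ennreal ((1 + 1 / n) ^ m)"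
      if i: "i \<in> ?I" for i
    proof -
      have "sets ?P = sets (Pi\<^sub>M ?I (\<lambda>_. borel))" by (intro sets_PiM_cong) auto
      hence "(\<lambda>x. ennreal (g i x)) \<in> Pi\<^sub>M ?I (\<lambda>_. borel) \<rightarrow>\<^sub>M borel"
        using g_measurable[OF i] by (simp cong: measurable_cong_sets)
      hence "indep_vars (\<lambda>_. borel) (\<lambda>j \<omega>. ennreal (g i (col j \<omega>))) ?J"
        unfolding col_def by (rule indep_vars_columns[OF assms(7)])
      hence "(\<integral>\<^sup>+\<omega>. (\<Prod>j\<in>?J. ennreal (g i (col j \<omega>))) \<partial>M) = (\<Prod>j\<in>?J. \<integral>\<^sup>+\<omega>. ennreal (g i (col j \<omega>)) \<partial>M)"
        by (intro indep_vars_nn_integral) auto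
      also have "\<dots> = (\<Prod>j\<in>?J. \<integral>\<^sup>+x. ennreal (g i x) \<partial>?P)"
      proof (rule prod.cong[OF refl])
        fix j assume j: "j \<in> ?J"
        have "(\<integral>\<^sup>+x. ennreal (g i x) \<partial>?P) = (\<integral>\<^sup>+x. ennreal (g i x) \<partial>distr M ?P (col j))"
          by (simp only: col_distr[OF j])
        also have "\<dots> = (\<integral>\<^sup>+\<omega>. ennreal (g i (col j \<omega>)) \<partial>M)"
          using col_measurable[OF j] g_measurable[OF i] by (intro nn_integral_distr) auto
        finally show "(\<integral>\<^sup>+\<omega>. ennreal (g i (col j \<omega>)) \<partial>M) = (\<integral>\<^sup>+x. ennreal (g i x) \<partial>?P)" ..
      qed
      also have "\<dots> \<le> (\<Prod>j\<in>?J. ennreal (1 + 1 / n))" by (intro prod_mono_ennreal g_moment i)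
      also have "\<dots> = ennreal ((1 + 1 / n) ^ m)" by (subst prod_ennreal) auto
      finally show ?thesis .
    qed
    have "(\<integral>\<^sup>+\<omega>. ennreal (W \<omega>) \<partial>M) = (\<integral>\<^sup>+\<omega>. (\<Sum>i\<in>?I. \<Prod>j\<in>?J. ennreal (g i (col j \<omega>))) \<partial>M)"
      by (intro nn_integral_cong)
         (simp add: W_def sum_ennreal prod_ennreal g_nonneg prod_nonneg)
    also have "\<dots> = (\<Sum>i\<in>?I. \<integral>\<^sup>+\<omega>. (\<Prod>j\<in>?J. ennreal (g i (col j \<omega>))) \<partial>M)"
      by (intro nn_integral_sum borel_measurable_prod_ennreal) measurable
    also have "\<dots> \<le> (\<Sum>i\<in>?I. ennreal ((1 + 1 / n) ^ m))" by (intro sum_mono prod)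
    also have "\<dots> = ennreal B" by (subst sum_ennreal) (auto simp: B_def)
    finally show ?thesis .
  qed
  have W_nonneg: "0 \<le> W \<omega>" for \<omega>
    by (auto simp: W_def intro!: sum_nonneg prod_nonneg g_nonneg)
  have [measurable]: "W \<in> borel_measurable M"
    unfolding W_def by (intro borel_measurable_sum borel_measurable_prod) measurable
  have W_int: "integrable M W"
    using W_nn W_nonneg by (intro integrableI_bounded) (auto intro: le_less_trans)
  have "ennreal (expectation W) \<le> ennreal B"
    using W_nn by (subst nn_integral_eq_integral[OF W_int, symmetric]) (use W_nonneg in auto)
  hence EW: "expectation W \<le> B" using B by (simp add: ennreal_le_iff)
  have VCG_le: "VCG n m (\<lambda>i j. t i j \<omega>) \<le> (ln B - 1 + W \<omega> / B) / s" for \<omega>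
  proof -
    have "(\<Prod>j\<in>?J. g i (col j \<omega>)) = (\<Prod>j\<in>?J. 1 + tie_share ?I i (\<lambda>i. t i j \<omega>) * (exp (s * Min ((\<lambda>i. t i j \<omega>) ` ?I)) - 1))"
      if "i \<in> ?I" for i
      unfolding g_def col_def by (simp only: tie_share_restrict[OF that])
    thus ?thesis
      using VCG_le_exponential[OF assms(2) s B, of m "\<lambda>i j. t i j \<omega>"] by (simp add: W_def)
  qed
  have Min_col: "Min (col j \<omega> ` ?I) = Min ((\<lambda>i. t i j \<omega>) ` ?I)" for j \<omega>
    by (rule arg_cong[where f = Min]) (auto simp: col_def)
  have Min_int: "integrable M (\<lambda>\<omega>. Min ((\<lambda>i. t i j \<omega>) ` ?I))"
    and Min_mean: "expectation (\<lambda>\<omega>. Min ((\<lambda>i. t i j \<omega>) ` ?I)) = \<mu>" if j: "j \<in> ?J" for j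
  proof -
    have "integrable (distr M ?P (col j)) (\<lambda>x. Min (x ` ?I))"
      using Min_integrable[OF assms(5,6) I] by (simp only: col_distr[OF j])
    thus "integrable M (\<lambda>\<omega>. Min ((\<lambda>i. t i j \<omega>) ` ?I))"
      using j by (subst (asm) integrable_distr_eq) (auto simp: Min_col simp del: One_nat_def)
    have "\<mu> = (\<integral>x. Min (x ` ?I) \<partial>distr M ?P (col j))"
      unfolding \<mu>_def by (simp only: col_distr[OF j])
    also have "\<dots> = expectation (\<lambda>\<omega>. Min ((\<lambda>i. t i j \<omega>) ` ?I))"
      using j by (subst integral_distr) (auto simp: Min_col simp del: One_nat_def)
    finally show "expectation (\<lambda>\<omega>. Min ((\<lambda>i. t i j \<omega>) ` ?I)) = \<mu>" ..
  qed
  have "expectation (\<lambda>\<omega>. VCG n m (\<lambda>i j. t i j \<omega>)) \<le> 2 * \<mu> * (ln n + m / n)"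
  \<comment> \<open>The case split replaces a proof that the VCG makespan is integrable: otherwise
    its Bochner integral is 0 by default, and the bound is nonnegative.\<close>
  proof (cases "integrable M (\<lambda>\<omega>. VCG n m (\<lambda>i j. t i j \<omega>))")
    case True
    have "expectation (\<lambda>\<omega>. VCG n m (\<lambda>i j. t i j \<omega>)) \<le> expectation (\<lambda>\<omega>. (ln B - 1 + W \<omega> / B) / s)"
      using W_int by (intro integral_mono True VCG_le) auto
    also have "\<dots> = (ln B - 1 + expectation W / B) / s" using W_int by (simp add: prob_space)
    \<comment> \<open>With \<open>B\<close> at least the mean of \<open>W\<close>, the terms
      \<open>- 1\<close> and \<open>expectation W / B\<close> together are at most 0.\<close>
    also have "\<dots> \<le> ln B / s"
      using EW B s by (intro divide_right_mono) (auto simp: field_simps)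
    also have "\<dots> = 2 * \<mu> * ln B" by (simp add: s_def)
    also have "ln B = ln n + m * ln (1 + 1 / n)"
    proof -
      have "0 < 1 + 1 / real n" using assms(2) by (simp add: add_pos_nonneg)
      thus ?thesis using assms(2) unfolding B_def
        by (subst ln_mult_pos) (simp_all add: ln_realpow)
    qed
    also have "2 * \<mu> * \<dots> \<le> 2 * \<mu> * (ln n + m * (1 / n))"
      using \<mu> ln_add_one_self_le_self[of "1 / real n"]
      by (intro mult_left_mono add_left_mono) auto
    finally show ?thesis by simp
  next
    case False
    thus ?thesis using \<mu> assms(2) by (simp add: not_integrable_integral_eq)
  qed
  \<comment> \<open>The assumption \<open>real m \<ge> real n * ln (real n)\<close> enters here, as
    \<open>ln n \<le> m / n\<close>.\<close>
  also have "\<dots> \<le> 2 * \<mu> * (m / n + m / n)"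
    using \<mu> assms(2,4) by (intro mult_left_mono add_right_mono) (auto simp: field_simps)
  also have "\<dots> = 4 * (m * \<mu> / n)" by simp
  also have "m * \<mu> / n = expectation (\<lambda>\<omega>. (\<Sum>j\<in>?J. Min ((\<lambda>i. t i j \<omega>) ` ?I)) / n)"
  proof -
    have "expectation (\<lambda>\<omega>. \<Sum>j\<in>?J. Min ((\<lambda>i. t i j \<omega>) ` ?I)) = m * \<mu>"
      using Min_int by (subst Bochner_Integration.integral_sum) (simp_all add: Min_mean del: One_nat_def)
    thus ?thesis by simp
  qed
  also have "4 * \<dots> \<le> 4 * expectation (\<lambda>\<omega>. OPT n m (\<lambda>i j. t i j \<omega>))"
  proof (intro mult_left_mono integral_mono)
    have t_int: "integrable M (t i j)" if "i \<in> ?I" "j \<in> ?J" for i j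
    proof -
      have "integrable (distr M borel (t i j)) (\<lambda>x. x)"
        using MHR_integrable[OF assms(5,6)] assms(8)[OF that] by simp
      thus ?thesis using that by (subst (asm) integrable_distr_eq) auto
    qed
    \<comment> \<open>On this side integrability has to be proved: the default value 0 of the
      integral would not satisfy the lower bound.\<close>
    show "integrable M (\<lambda>\<omega>. OPT n m (\<lambda>i j. t i j \<omega>))"
    proof (rule Bochner_Integration.integrable_bound)
      show "integrable M (\<lambda>\<omega>. \<Sum>i\<in>?I. \<Sum>j\<in>?J. \<bar>t i j \<omega>\<bar>)"
        using t_int by (intro Bochner_Integration.integrable_sum integrable_abs)
      show "(\<lambda>\<omega>. OPT n m (\<lambda>i j. t i j \<omega>)) \<in> borel_measurable M"
        by (rule OPT_measurable[OF rv])
      show "AE \<omega> in M. norm (OPT n m (\<lambda>i j. t i j \<omega>)) \<le> norm (\<Sum>i\<in>?I. \<Sum>j\<in>?J. \<bar>t i j \<omega>\<bar>)"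
        using abs_OPT_le[OF assms(2)] by (auto intro: order_trans[OF _ abs_ge_self])
    qed
    show "integrable M (\<lambda>\<omega>. (\<Sum>j\<in>?J. Min ((\<lambda>i. t i j \<omega>) ` ?I)) / n)"
      by (intro integrable_divide Bochner_Integration.integrable_sum Min_int)
    show "(\<Sum>j\<in>?J. Min ((\<lambda>i. t i j \<omega>) ` ?I)) / n \<le> OPT n m (\<lambda>i j. t i j \<omega>)" for \<omega>
      by (rule OPT_ge_average[OF assms(2)])
  qed simp
  finally show ?thesis by simp
qed

end
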